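(* Let a dumbbell and point mass body be in an isosceles relative equilibrium (RE), that is, an RE of the planar dumbbell/point mass problem with $d_1=d_2$. The $x_1M_1$-plane divides into regions which differ by the possible number of RE. Particularly, for $M_1<\frac{12x_1x_2}{(x_1-x_2)^2+16x_1x_2}$, and as $L^2$ increases from zero, we initially have no RE until a bifurcation point at $L_b=\sqrt[4]{\frac{256}{27}BM_2}$, where two RE appear at $r_b=\sqrt{B(3-4M_1)}$. Subsequently, an RE merges with the origin. As a result, we have zero, then two, then one RE. For larger $M_1$, the bifurcation curve $r\mapsto L^2(r)$ has no local minima, but does have an absolute minimum at $r=\frac{|x_2-x_1|}{2}$. Therefore, we have zero, then one RE as $L^2$ increases from zero.
   Context: Planar dumbbell/point mass problem: a point mass body of mass $M_1$ and a dumbbell of total mass $M_2$ (with $M_1+M_2=1$, $M_1,M_2>0$) move in a plane under Newtonian gravity ($G=1$). The origin of the reference frame is the system's center of mass. The dumbbell consists of two point masses $M_2x_1$, $M_2x_2$ ($x_1+x_2=1$, $x_i>0$) joined by a massless rod of length $1$. Let $\vec r$ be the vector from the point mass body to the dumbbell's center of mass, $r=|\vec r|>0$, and $\theta$ the angle between $\vec r$ and the rod. The distances from the point mass body to the dumbbell masses are $d_1=\sqrt{r^2-2x_2r\cos\theta+x_2^2}$ and $d_2=\sqrt{r^2+2x_1r\cos\theta+x_1^2}$. Put $B=\frac{x_1x_2}{M_1}$ (the dumbbell's scaled moment of inertia about its center of mass). The (scaled) amended potential for angular momentum $L$ is $$V(r,\theta)=\frac{L^2}{2(r^2+B)}-\frac{x_1}{d_1}-\frac{x_2}{d_2}.$$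 A relative equilibrium (RE) with angular momentum $L$ is a critical point $(r,\theta)$ of $V$. The condition $d_1=d_2$ is equivalent to $\cos\theta=\frac{x_2-x_1}{2r}$, so the radius satisfies $r\ge\frac{|x_2-x_1|}{2}$; isosceles RE are counted by their radius $r$. With $d_1=d_2$ one has $\partial_\theta V=0$, and $\partial_rV=0$ is equivalent to $L^2=L^2(r)$, where $$L^2(r)=\frac{(r^2+B)^2}{(r^2+M_1B)^{3/2}}$$ is the bifurcation curve, with $L^2$ as the bifurcation parameter.
   Formalization: "An RE merges with the origin" is proved as: the inner RE's radius tends to the least admissible radius |x2-x1|/2 and then disappears; this is the origin only if x1=x2, since otherwise isosceles RE have r ≥ |x2-x1|/2 > 0 and cannot reach the origin. *)

theory Defs
  imports "HOL-Analysis.Analysis"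
begin

definition d1 :: "real \<Rightarrow> real \<Rightarrow> real \<Rightarrow> real" where
  "d1 x2 r \<theta> = sqrt (r\<^sup>2 - 2 * x2 * r * cos \<theta> + x2\<^sup>2)"

definition d2 :: "real \<Rightarrow> real \<Rightarrow> real \<Rightarrow> real" where
  "d2 x1 r \<theta> = sqrt (r\<^sup>2 + 2 * x1 * r * cos \<theta> + x1\<^sup>2)"

definition inertia :: "real \<Rightarrow> real \<Rightarrow> real \<Rightarrow> real" where
  "inertia x1 x2 M1 = x1 * x2 / M1"

definition amended_potential ::
  "real \<Rightarrow> real \<Rightarrow> real \<Rightarrow> real \<Rightarrow> real \<Rightarrow> real \<Rightarrow> real" where
  "amended_potential x1 x2 M1 L r \<theta> =
     L\<^sup>2 / (2 * (r\<^sup>2 + inertia x1 x2 M1)) - x1 / d1 x2 r \<theta> - x2 / d2 x1 r \<theta>"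

text \<open>The first three conjuncts describe the domain of the amended potential: positive
  separation and no collision (HOL's division by zero would otherwise assign it a value there).\<close>

definition relative_equilibrium ::
  "real \<Rightarrow> real \<Rightarrow> real \<Rightarrow> real \<Rightarrow> real \<Rightarrow> real \<Rightarrow> bool" where
  "relative_equilibrium x1 x2 M1 L r \<theta> \<longleftrightarrow>
     r > 0 \<and> d1 x2 r \<theta> \<noteq> 0 \<and> d2 x1 r \<theta> \<noteq> 0 \<and>
     ((\<lambda>(r, \<theta>). amended_potential x1 x2 M1 L r \<theta>) has_derivative (\<lambda>_. 0)) (at (r, \<theta>))"

text \<open>Isosceles relative equilibria are counted by their radius: the angles \<open>\<theta>\<close> and \<open>- \<theta>\<close>
  (and translates by \<open>2\<pi>\<close>) belonging to one radius are not distinguished.\<close>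

definition isosceles_RE_radii :: "real \<Rightarrow> real \<Rightarrow> real \<Rightarrow> real \<Rightarrow> real set" where
  "isosceles_RE_radii x1 x2 M1 L =
     {r. \<exists>\<theta>. relative_equilibrium x1 x2 M1 L r \<theta> \<and> d1 x2 r \<theta> = d2 x1 r \<theta>}"

text \<open>If \<open>d1 = d2\<close> then \<open>cos \<theta> = (x2 - x1) / (2 * r)\<close>, which bounds the radius from below.\<close>

definition min_radius :: "real \<Rightarrow> real \<Rightarrow> real" where
  "min_radius x1 x2 = \<bar>x2 - x1\<bar> / 2"

text \<open>The value of \<open>L\<^sup>2\<close> for which an isosceles configuration of radius \<open>r\<close> is a relative
  equilibrium.\<close>

definition bifurcation_curve :: "real \<Rightarrow> real \<Rightarrow> real \<Rightarrow> real \<Rightarrow> real" where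
  "bifurcation_curve x1 x2 M1 r =
     (r\<^sup>2 + inertia x1 x2 M1)\<^sup>2 / (r\<^sup>2 + M1 * inertia x1 x2 M1) powr (3 / 2)"

definition L_bif :: "real \<Rightarrow> real \<Rightarrow> real \<Rightarrow> real \<Rightarrow> real" where
  "L_bif x1 x2 M1 M2 = root 4 (256 / 27 * inertia x1 x2 M1 * M2)"

definition r_bif :: "real \<Rightarrow> real \<Rightarrow> real \<Rightarrow> real" where
  "r_bif x1 x2 M1 = sqrt (inertia x1 x2 M1 * (3 - 4 * M1))"

definition critical_mass :: "real \<Rightarrow> real \<Rightarrow> real" where
  "critical_mass x1 x2 = 12 * x1 * x2 / ((x1 - x2)\<^sup>2 + 16 * x1 * x2)"

definition local_min_on :: "(real \<Rightarrow> real) \<Rightarrow> real set \<Rightarrow> real \<Rightarrow> bool" where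
  "local_min_on f S x \<longleftrightarrow> x \<in> S \<and> (\<forall>\<^sub>F y in at x within S. f x \<le> f y)"

end

theory Submission
  imports Defs
begin

text \<open>On an isosceles configuration the angular derivative of the potential vanishes and both
  distances equal \<open>sqrt (r\<^sup>2 + x1 * x2)\<close>, so the isosceles equilibria at angular momentum \<open>L\<close>
  are the radii \<open>r \<ge> min_radius\<close> at which the bifurcation curve takes the value \<open>L\<^sup>2\<close>.
  In the variable \<open>s = r\<^sup>2\<close> the derivative of that curve has the sign of
  \<open>s - B * (3 - 4 * M1)\<close>. Hence it either has the shape of a valley with bottom at \<open>r_bif\<close>
  (when \<open>r_bif > min_radius\<close>, which is the condition \<open>M1 < critical_mass\<close>) or is strictly
  increasing; the branches \<open>\<rho>\<^sub>i\<close> and \<open>\<rho>\<^sub>o\<close> are the inverses of its two monotone pieces.\<close>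

section \<open>Isosceles configurations and critical points of the potential\<close>

lemma isosceles_iff:
  assumes "x1 + x2 = 1" "r > 0"
  shows "d1 x2 r \<theta> = d2 x1 r \<theta> \<longleftrightarrow> cos \<theta> = (x2 - x1) / (2 * r)"
proof -
  have "r\<^sup>2 + 2 * x1 * r * cos \<theta> + x1\<^sup>2 - (r\<^sup>2 - 2 * x2 * r * cos \<theta> + x2\<^sup>2)
      = (x1 + x2) * (2 * r * cos \<theta> - (x2 - x1))"
    by (simp add: algebra_simps power2_eq_square)
  with assms have "d1 x2 r \<theta> = d2 x1 r \<theta> \<longleftrightarrow> 2 * r * cos \<theta> = x2 - x1"
    unfolding d1_def d2_def real_sqrt_eq_iff by auto
  also have "\<dots> \<longleftrightarrow> cos \<theta> = (x2 - x1) / (2 * r)"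
    using assms by (auto simp: field_simps)
  finally show ?thesis .
qed

text \<open>Substituting \<open>2 * r * cos \<theta> = x2 - x1\<close> leaves the constant term
  \<open>x1 * x2\<close>, which is \<open>M1 * B\<close>. This is where the base of the denominator
  of \<open>bifurcation_curve\<close> comes from.\<close>

lemma isosceles_distances:
  fixes r x1 x2 \<theta> :: real
  assumes "x1 + x2 = 1" "r > 0" "cos \<theta> = (x2 - x1) / (2 * r)"
  shows "r\<^sup>2 - 2 * x2 * r * cos \<theta> + x2\<^sup>2 = r\<^sup>2 + x1 * x2"
    and "r\<^sup>2 + 2 * x1 * r * cos \<theta> + x1\<^sup>2 = r\<^sup>2 + x1 * x2"
proof -
  have x1: "x1 = 1 - x2" using assms(1) by simp
  show "r\<^sup>2 - 2 * x2 * r * cos \<theta> + x2\<^sup>2 = r\<^sup>2 + x1 * x2"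
    and "r\<^sup>2 + 2 * x1 * r * cos \<theta> + x1\<^sup>2 = r\<^sup>2 + x1 * x2"
    using assms(2) unfolding assms(3) x1 by (simp_all add: field_simps power2_eq_square)
qed

text \<open>Both attraction terms are instances: \<open>m = - x2\<close> and \<open>x = x1\<close>
  give \<open>x1 / d1\<close>, while \<open>m = x1\<close> and \<open>x = x2\<close> give
  \<open>x2 / d2\<close>.\<close>

lemma attraction_has_derivative:
  fixes r \<theta> m x :: real
  assumes "r\<^sup>2 + 2 * m * r * cos \<theta> + m\<^sup>2 > 0" (is "?a > 0")
  shows "((\<lambda>p. x / sqrt ((fst p)\<^sup>2 + 2 * m * fst p * cos (snd p) + m\<^sup>2)) has_derivative
    (\<lambda>p. x * (m * r * sin \<theta> * snd p - (r + m * cos \<theta>) * fst p) / sqrt ?a ^ 3)) (at (r, \<theta>))"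
proof -
  let ?q = "\<lambda>p::real \<times> real. (fst p)\<^sup>2 + 2 * m * fst p * cos (snd p) + m\<^sup>2"
  have q: "(?q has_derivative
      (\<lambda>p. 2 * ((r + m * cos \<theta>) * fst p - m * r * sin \<theta> * snd p))) (at (r, \<theta>))"
    by (auto intro!: derivative_eq_intros simp: algebra_simps)
  have "((\<lambda>u. x / sqrt u) has_real_derivative - x / (2 * sqrt ?a ^ 3)) (at ?a)"
    using assms
    by (auto intro!: derivative_eq_intros simp: field_simps power2_eq_square power3_eq_cube)
  then have "((\<lambda>u. x / sqrt u) has_real_derivative - x / (2 * sqrt ?a ^ 3)) (at (?q (r, \<theta>)))"
    by simp
  from DERIV_compose_FDERIV[OF this q] show ?thesis
    by (rule has_derivative_eq_rhs)
      (simp add: fun_eq_iff right_diff_distrib diff_divide_distrib mult.commute)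
qed

text \<open>The angular coefficient is kept as a multiple of the difference of the inverse cubed
  distances, so that it visibly vanishes once the distances agree.\<close>

lemma amended_potential_has_derivative:
  assumes B: "r\<^sup>2 + inertia x1 x2 M1 \<noteq> 0"
    and a: "r\<^sup>2 - 2 * x2 * r * cos \<theta> + x2\<^sup>2 > 0" (is "?a > 0")
    and b: "r\<^sup>2 + 2 * x1 * r * cos \<theta> + x1\<^sup>2 > 0" (is "?b > 0")
  shows "((\<lambda>(r, \<theta>). amended_potential x1 x2 M1 L r \<theta>) has_derivative
    (\<lambda>(h, k).
      h * (x1 * (r - x2 * cos \<theta>) / sqrt ?a ^ 3 + x2 * (r + x1 * cos \<theta>) / sqrt ?b ^ 3
           - L\<^sup>2 * r / (r\<^sup>2 + inertia x1 x2 M1)\<^sup>2)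
      + k * (x1 * x2 * r * sin \<theta> * (1 / sqrt ?a ^ 3 - 1 / sqrt ?b ^ 3)))) (at (r, \<theta>))"
proof -
  have "((\<lambda>s. L\<^sup>2 / (2 * (s\<^sup>2 + inertia x1 x2 M1))) has_real_derivative
      - L\<^sup>2 * r / (r\<^sup>2 + inertia x1 x2 M1)\<^sup>2) (at r)"
    using B by (auto intro!: derivative_eq_intros simp: divide_simps)
      (simp add: algebra_simps power2_eq_square)
  then have "((\<lambda>s. L\<^sup>2 / (2 * (s\<^sup>2 + inertia x1 x2 M1))) has_real_derivative
      - L\<^sup>2 * r / (r\<^sup>2 + inertia x1 x2 M1)\<^sup>2) (at (fst (r, \<theta>)))"
    by simp
  from DERIV_compose_FDERIV[OF this has_derivative_fst[OF has_derivative_ident]]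
  have "((\<lambda>p. L\<^sup>2 / (2 * ((fst p)\<^sup>2 + inertia x1 x2 M1))) has_derivative
      (\<lambda>p. fst p * (- L\<^sup>2 * r / (r\<^sup>2 + inertia x1 x2 M1)\<^sup>2))) (at (r, \<theta>))"
    by simp
  from has_derivative_diff[OF has_derivative_diff[OF this
        attraction_has_derivative[of r "- x2" \<theta> x1, simplified, OF a]]
      attraction_has_derivative[of r x1 \<theta> x2, OF b]]
  show ?thesis
    unfolding amended_potential_def d1_def d2_def case_prod_beta'
    by (rule has_derivative_eq_rhs)
      (simp_all add: fun_eq_iff distrib_left right_diff_distrib diff_divide_distrib
        add_divide_distrib mult_ac)
qed

lemma relative_equilibrium_isosceles_iff:
  assumes "x1 > 0" "x2 > 0" "x1 + x2 = 1" "M1 > 0" "r > 0" "cos \<theta> = (x2 - x1) / (2 * r)"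
  shows "relative_equilibrium x1 x2 M1 L r \<theta> \<longleftrightarrow> bifurcation_curve x1 x2 M1 r = L\<^sup>2"
proof -
  note dist = isosceles_distances[OF assms(3,5,6)]
  define B where "B = inertia x1 x2 M1"
  define d where "d = sqrt (r\<^sup>2 + x1 * x2)"
  have B: "B > 0" "M1 * B = x1 * x2"
    using assms by (auto simp: B_def inertia_def)
  have pos: "r\<^sup>2 + x1 * x2 > 0" "r\<^sup>2 + B > 0"
    using assms B by (auto intro!: add_pos_pos)
  then have d: "d > 0" by (simp add: d_def)
  \<comment> \<open>The two terms in \<open>c\<close> have opposite coefficients and cancel, so over
    a common distance the radial component no longer depends on the angle.\<close>
  have "x1 * (r - x2 * c) / e + x2 * (r + x1 * c) / e = (x1 + x2) * r / e" for c e
    by (simp add: field_simps flip: add_divide_distrib)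
  then have combine: "x1 * (r - x2 * c) / e + x2 * (r + x1 * c) / e = r / e" for c e
    using assms by simp
  define D where "D = r / d ^ 3 - L\<^sup>2 * r / (r\<^sup>2 + B)\<^sup>2"
  have "((\<lambda>(r, \<theta>). amended_potential x1 x2 M1 L r \<theta>) has_derivative
      (\<lambda>(h, k). h * (x1 * (r - x2 * cos \<theta>) / d ^ 3 + x2 * (r + x1 * cos \<theta>) / d ^ 3
        - L\<^sup>2 * r / (r\<^sup>2 + B)\<^sup>2) + k * (x1 * x2 * r * sin \<theta> * (1 / d ^ 3 - 1 / d ^ 3))))
      (at (r, \<theta>))"
    using amended_potential_has_derivative[of r x1 x2 M1 \<theta> L, unfolded dist,
        OF _ pos(1) pos(1)] pos(2)
    unfolding B_def d_def by simp
  then have der: "((\<lambda>(r, \<theta>). amended_potential x1 x2 M1 L r \<theta>) has_derivative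
      (\<lambda>(h, k). h * D)) (at (r, \<theta>))"
    unfolding combine by (simp only: D_def diff_self mult_zero_right add_0_right)
  have zero: "(\<lambda>(h, k). h * D) = (\<lambda>_::real \<times> real. 0) \<longleftrightarrow> D = 0"
    by (auto simp: fun_eq_iff)
  have "relative_equilibrium x1 x2 M1 L r \<theta> \<longleftrightarrow> D = 0"
  proof -
    have "d1 x2 r \<theta> \<noteq> 0" "d2 x1 r \<theta> \<noteq> 0"
      unfolding d1_def d2_def dist using d by (simp_all add: d_def)
    \<comment> \<open>One direction is the derivative formula; the other is uniqueness of the
      derivative, which forces the map with slope \<open>D\<close> to be zero.\<close>
    then show ?thesis
      using der has_derivative_unique[OF der] zero assms(5)
      unfolding relative_equilibrium_def by metis
  qed
  also have "\<dots> \<longleftrightarrow> (r\<^sup>2 + B)\<^sup>2 / d ^ 3 = L\<^sup>2"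
  proof -
    have "D = 0 \<longleftrightarrow> r / d ^ 3 = L\<^sup>2 * r / (r\<^sup>2 + B)\<^sup>2"
      by (simp add: D_def)
    also have "\<dots> \<longleftrightarrow> (r\<^sup>2 + B)\<^sup>2 / d ^ 3 = L\<^sup>2"
      using assms(5) pos(2) d by (simp add: divide_simps mult_ac)
    finally show ?thesis .
  qed
  also have "d ^ 3 = (r\<^sup>2 + x1 * x2) powr (3 / 2)"
    using pos d by (simp add: d_def powr_half_sqrt[symmetric] powr_power)
  finally show ?thesis
    unfolding bifurcation_curve_def B_def[symmetric] B(2) .
qed

text \<open>The cosine takes exactly the values in [-1, 1], so a suitable angle exists precisely
  from \<open>min_radius\<close> on. The intersection with \<open>{0<..}\<close> can remove only the
  radius 0, and only when \<open>x1 = x2\<close>; writing it separately leaves a level set on a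
  closed half line, to which the monotone branches apply.\<close>

lemma isosceles_RE_radii_eq:
  assumes "x1 > 0" "x2 > 0" "x1 + x2 = 1" "M1 > 0"
  shows "isosceles_RE_radii x1 x2 M1 L =
    {r \<in> {min_radius x1 x2..}. bifurcation_curve x1 x2 M1 r = L\<^sup>2} \<inter> {0<..}"
proof -
  have "(\<exists>\<theta>. relative_equilibrium x1 x2 M1 L r \<theta> \<and> d1 x2 r \<theta> = d2 x1 r \<theta>) \<longleftrightarrow>
      min_radius x1 x2 \<le> r \<and> bifurcation_curve x1 x2 M1 r = L\<^sup>2" if r: "r > 0" for r
  proof -
    have "(\<exists>\<theta>. cos \<theta> = c) \<longleftrightarrow> \<bar>c\<bar> \<le> 1" for c :: real
      using cos_arccos_abs abs_cos_le_one by metis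
    then have "(\<exists>\<theta>. cos \<theta> = (x2 - x1) / (2 * r)) \<longleftrightarrow> min_radius x1 x2 \<le> r"
      using r by (simp add: min_radius_def abs_divide divide_le_eq mult.commute)
    then show ?thesis
      using isosceles_iff[OF assms(3) r] relative_equilibrium_isosceles_iff[OF assms r] by metis
  qed
  moreover have "relative_equilibrium x1 x2 M1 L r \<theta> \<Longrightarrow> r > 0" for r \<theta>
    by (simp add: relative_equilibrium_def)
  ultimately show ?thesis
    unfolding isosceles_RE_radii_def by (intro set_eqI) (simp, blast)
qed

section \<open>Monotonicity and size of the bifurcation curve\<close>

lemma curve_in_squared_radius_has_derivative:
  fixes B c s :: real
  assumes "s + B > 0" "s + c > 0"
  shows "((\<lambda>s. (s + B)\<^sup>2 / (s + c) powr (3 / 2)) has_real_derivative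
    (s + B) * (s + 4 * c - 3 * B) / (2 * (s + c) powr (5 / 2))) (at s)"
proof -
  \<comment> \<open>All powers are reduced to \<open>(s + c) powr (1 / 2)\<close>, which turns the
    simplification of the quotient rule into an identity of rational expressions.\<close>
  have e: "(s + c) powr (5 / 2) = (s + c) * (s + c) powr (3 / 2)"
    "(s + c) powr (1 / 2) * (s + c) = (s + c) powr (3 / 2)"
    using assms powr_add[of "s + c" 1 "3 / 2"] powr_add[of "s + c" "1 / 2" 1] by simp_all
  have "((\<lambda>s. (s + B)\<^sup>2 / (s + c) powr (3 / 2)) has_real_derivative
    (2 * (s + B) * (s + c) powr (3 / 2) - (s + B)\<^sup>2 * (3 / 2 * (s + c) powr (1 / 2)))
      / ((s + c) powr (3 / 2))\<^sup>2) (at s)"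
    using assms by (auto intro!: derivative_eq_intros simp: power2_eq_square)
  also have "(2 * (s + B) * (s + c) powr (3 / 2) - (s + B)\<^sup>2 * (3 / 2 * (s + c) powr (1 / 2)))
      / ((s + c) powr (3 / 2))\<^sup>2 = (s + B) * (s + 4 * c - 3 * B) / (2 * (s + c) powr (5 / 2))"
    using assms unfolding e(1) e(2)[symmetric]
    by (simp add: divide_simps) (simp add: algebra_simps power2_eq_square)
  finally show ?thesis .
qed

lemma bifurcation_curve_continuous:
  assumes "inertia x1 x2 M1 > 0" "M1 > 0"
  shows "continuous_on S (bifurcation_curve x1 x2 M1)"
proof -
  have "r\<^sup>2 + M1 * inertia x1 x2 M1 > 0" for r
    using assms by (intro add_nonneg_pos) auto
  then show ?thesis
    unfolding bifurcation_curve_def by (intro continuous_intros) (auto simp: less_imp_neq[symmetric])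
qed

text \<open>For \<open>c = M1 * B\<close> the linear factor of the derivative is
  \<open>s - B * (3 - 4 * M1)\<close>, positive for \<open>s > m\<^sup>2\<close>. The sign is used
  only at interior points, so the derivative may vanish at the left end, as it does for
  \<open>m = r_bif\<close>.\<close>

lemma bifurcation_curve_strict_mono:
  assumes B: "inertia x1 x2 M1 > 0" "M1 > 0"
    and m: "m \<ge> 0" "inertia x1 x2 M1 * (3 - 4 * M1) \<le> m\<^sup>2"
  shows "strict_mono_on {m..} (bifurcation_curve x1 x2 M1)"
proof (rule strict_mono_onI)
  fix r t assume rt: "r \<in> {m..}" "t \<in> {m..}" "r < t"
  let ?B = "inertia x1 x2 M1"
  let ?G = "\<lambda>s. (s + ?B)\<^sup>2 / (s + M1 * ?B) powr (3 / 2)"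
  have mr: "m\<^sup>2 \<le> r\<^sup>2" "r\<^sup>2 < t\<^sup>2"
    using rt m by (auto intro: power_mono power_strict_mono)
  have pos: "s + ?B > 0" "s + M1 * ?B > 0" if "s \<ge> 0" for s
    using that B by (auto intro: add_nonneg_pos)
  have "?G (r\<^sup>2) < ?G (t\<^sup>2)"
  proof (rule DERIV_pos_imp_increasing_open[OF mr(2)])
    fix s assume s: "r\<^sup>2 < s" "s < t\<^sup>2"
    have "r\<^sup>2 \<ge> 0" by simp
    with s have "s \<ge> 0" by linarith
    moreover have "s + 4 * (M1 * ?B) - 3 * ?B > 0"
      using s mr m by (simp add: algebra_simps)
    ultimately have "(s + ?B) * (s + 4 * (M1 * ?B) - 3 * ?B) / (2 * (s + M1 * ?B) powr (5 / 2)) > 0"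
      using pos[of s] by (intro divide_pos_pos mult_pos_pos) auto
    then show "\<exists>y. (?G has_real_derivative y) (at s) \<and> y > 0"
      using curve_in_squared_radius_has_derivative[OF pos[OF \<open>s \<ge> 0\<close>]] by blast
  next
    have "s \<ge> 0" if "r\<^sup>2 \<le> s" for s
      using that zero_le_power2[of r] by linarith
    then show "continuous_on {r\<^sup>2..t\<^sup>2} ?G"
      using pos by (intro continuous_intros) (auto simp: less_imp_neq[symmetric])
  qed
  then show "bifurcation_curve x1 x2 M1 r < bifurcation_curve x1 x2 M1 t"
    by (simp add: bifurcation_curve_def)
qed

text \<open>The same factor is negative below its zero; this gives the inner slope of the
  valley.\<close>

lemma bifurcation_curve_strict_antimono:
  assumes B: "inertia x1 x2 M1 > 0" "M1 > 0"
    and m: "a \<ge> 0" "m\<^sup>2 \<le> inertia x1 x2 M1 * (3 - 4 * M1)"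
  shows "strict_antimono_on {a..m} (bifurcation_curve x1 x2 M1)"
proof (rule monotone_onI)
  fix r t assume rt: "r \<in> {a..m}" "t \<in> {a..m}" "r < t"
  let ?B = "inertia x1 x2 M1"
  let ?G = "\<lambda>s. (s + ?B)\<^sup>2 / (s + M1 * ?B) powr (3 / 2)"
  have mr: "t\<^sup>2 \<le> m\<^sup>2" "r\<^sup>2 < t\<^sup>2"
    using rt m by (auto intro: power_mono power_strict_mono)
  have pos: "s + ?B > 0" "s + M1 * ?B > 0" if "s \<ge> 0" for s
    using that B by (auto intro: add_nonneg_pos)
  have "?G (r\<^sup>2) > ?G (t\<^sup>2)"
  proof (rule DERIV_neg_imp_decreasing_open[OF mr(2)])
    fix s assume s: "r\<^sup>2 < s" "s < t\<^sup>2"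
    have "r\<^sup>2 \<ge> 0" by simp
    with s have "s \<ge> 0" by linarith
    moreover have "s + 4 * (M1 * ?B) - 3 * ?B < 0"
      using s mr m by (simp add: algebra_simps)
    ultimately have "(s + ?B) * (s + 4 * (M1 * ?B) - 3 * ?B) / (2 * (s + M1 * ?B) powr (5 / 2)) < 0"
      using pos[of s] by (intro divide_neg_pos mult_pos_neg) auto
    then show "\<exists>y. (?G has_real_derivative y) (at s) \<and> y < 0"
      using curve_in_squared_radius_has_derivative[OF pos[OF \<open>s \<ge> 0\<close>]] by blast
  next
    have "s \<ge> 0" if "r\<^sup>2 \<le> s" for s
      using that zero_le_power2[of r] by linarith
    then show "continuous_on {r\<^sup>2..t\<^sup>2} ?G"
      using pos by (intro continuous_intros) (auto simp: less_imp_neq[symmetric])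
  qed
  then show "bifurcation_curve x1 x2 M1 t < bifurcation_curve x1 x2 M1 r"
    by (simp add: bifurcation_curve_def)
qed

text \<open>Since \<open>M1 \<le> 1\<close>, the base \<open>u\<close> of the denominator is at most
  \<open>r\<^sup>2 + B\<close>, so the curve is at least \<open>sqrt u\<close>, hence at least
  \<open>r\<close>. This growth bound makes the increasing branch reach every high level.\<close>

lemma bifurcation_curve_ge:
  assumes "inertia x1 x2 M1 > 0" "M1 > 0" "M1 \<le> 1"
  shows "r \<le> bifurcation_curve x1 x2 M1 r"
proof -
  define u where "u = r\<^sup>2 + M1 * inertia x1 x2 M1"
  have u: "r\<^sup>2 < u" "0 < u" "u \<le> r\<^sup>2 + inertia x1 x2 M1"
    using assms by (auto simp: u_def add_nonneg_pos mult_left_le_one_le)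
  have "r \<le> sqrt u"
    using u by (intro real_le_rsqrt) simp
  also have "sqrt u = u\<^sup>2 / u powr (3 / 2)"
    using u powr_diff[of u 2 "3 / 2"] by (simp add: powr_half_sqrt)
  also have "\<dots> \<le> (r\<^sup>2 + inertia x1 x2 M1)\<^sup>2 / u powr (3 / 2)"
    using u by (intro divide_right_mono power_mono) auto
  finally show ?thesis
    by (simp add: bifurcation_curve_def u_def)
qed

lemma bifurcation_curve_pos:
  assumes "inertia x1 x2 M1 > 0" "M1 > 0"
  shows "0 < bifurcation_curve x1 x2 M1 r"
proof -
  have "r\<^sup>2 + inertia x1 x2 M1 > 0" "r\<^sup>2 + M1 * inertia x1 x2 M1 > 0"
    using assms by (auto intro: add_nonneg_pos)
  then show ?thesis
    by (simp add: bifurcation_curve_def)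
qed

section \<open>Closed forms for the bifurcation level and the critical mass\<close>

lemma L_bif_squared:
  assumes "inertia x1 x2 M1 > 0" "M2 > 0" "M1 + M2 = 1" "M1 \<le> 3 / 4"
  shows "(L_bif x1 x2 M1 M2)\<^sup>2 = bifurcation_curve x1 x2 M1 (r_bif x1 x2 M1)"
proof -
  define B where "B = inertia x1 x2 M1"
  define X where "X = B * M2"
  have M1: "M1 = 1 - M2" and X: "X > 0"
    using assms by (simp_all add: X_def B_def)
  have "(r_bif x1 x2 M1)\<^sup>2 = B * (3 - 4 * M1)"
    using assms by (simp add: r_bif_def B_def)
  \<comment> \<open>The constant 256 / 27 originates here: the bases become \<open>4 * X\<close> and
    \<open>3 * X\<close>, and the square of the curve value is
    \<open>256 * X ^ 4 / (27 * X ^ 3)\<close>. Nonnegativity undoes the squaring at the end.\<close>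
  then have "(r_bif x1 x2 M1)\<^sup>2 + B = 4 * X" "(r_bif x1 x2 M1)\<^sup>2 + M1 * B = 3 * X"
    by (simp_all add: X_def M1 algebra_simps)
  then have "bifurcation_curve x1 x2 M1 (r_bif x1 x2 M1) = (4 * X)\<^sup>2 / (3 * X) powr (3 / 2)"
    by (simp add: bifurcation_curve_def flip: B_def)
  moreover have "((3 * X) powr (3 / 2))\<^sup>2 = (3 * X) ^ 3"
    using X by (simp add: powr_power)
  ultimately have "(bifurcation_curve x1 x2 M1 (r_bif x1 x2 M1))\<^sup>2 = ((4 * X)\<^sup>2)\<^sup>2 / (3 * X) ^ 3"
    by (simp only: power_divide)
  also have "\<dots> = 256 / 27 * (B * M2)"
    using X unfolding X_def[symmetric] by (simp add: field_simps power2_eq_square power3_eq_cube)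
  finally have "(bifurcation_curve x1 x2 M1 (r_bif x1 x2 M1))\<^sup>2 = 256 / 27 * (B * M2)" .
  moreover have "((L_bif x1 x2 M1 M2)\<^sup>2)\<^sup>2 = 256 / 27 * (B * M2)"
    using assms by (simp add: L_bif_def B_def flip: power_mult)
  moreover have "bifurcation_curve x1 x2 M1 (r_bif x1 x2 M1) \<ge> 0"
    by (simp add: bifurcation_curve_def)
  ultimately show ?thesis
    by (metis power2_eq_iff_nonneg zero_le_power2)
qed

text \<open>Dropping \<open>(x1 - x2)\<^sup>2\<close> from the denominator gives 12 / 16. Hence any
  \<open>M1\<close> below the critical mass makes the radicand of \<open>r_bif\<close>
  positive.\<close>

lemma critical_mass_bounds:
  assumes "x1 > 0" "x2 > 0"
  shows "0 < critical_mass x1 x2" "critical_mass x1 x2 \<le> 3 / 4"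
proof -
  have "x1 * x2 > 0"
    using assms by simp
  then show "0 < critical_mass x1 x2" "critical_mass x1 x2 \<le> 3 / 4"
    by (auto simp: critical_mass_def field_simps add_pos_nonneg add_nonneg_pos)
qed

text \<open>Clearing denominators turns both sides into
  \<open>M1 * ((x1 - x2)\<^sup>2 + 16 * x1 * x2) < 12 * x1 * x2\<close>. The critical mass is thus
  where the zero of the derivative meets the smallest admissible squared radius.\<close>

lemma less_critical_mass_iff:
  assumes "x1 > 0" "x2 > 0" "M1 > 0"
  shows "M1 < critical_mass x1 x2 \<longleftrightarrow> (min_radius x1 x2)\<^sup>2 < inertia x1 x2 M1 * (3 - 4 * M1)"
proof -
  have "x1 * x2 > 0" using assms by simp
  then have "(x1 - x2)\<^sup>2 + 16 * x1 * x2 > 0"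
    by (intro add_nonneg_pos) auto
  then show ?thesis
    using assms unfolding critical_mass_def min_radius_def inertia_def
    by (simp add: power_divide field_simps power2_eq_square)
qed

section \<open>Inverse branches and level sets\<close>

lemma strict_mono_level_homeomorphism:
  fixes F :: "real \<Rightarrow> real"
  assumes "continuous_on {m..} F" "strict_mono_on {m..} F" "\<And>r. r \<le> F r"
  shows "\<exists>g. homeomorphism {m..} {F m..} F g"
proof (rule homeomorphism_into_1d[OF convex_imp_path_connected])
  show "F ` {m..} = {F m..}"
  proof (intro equalityI subsetI)
    fix y assume "y \<in> F ` {m..}"
    then show "y \<in> {F m..}"
      using strict_mono_on_leD[OF assms(2)] by auto
  next
    fix y assume y: "y \<in> {F m..}"
    \<comment> \<open>The endpoint \<open>max m y\<close> works for the intermediate value theorem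
      because \<open>y \<le> max m y \<le> F (max m y)\<close>.\<close>
    have "\<exists>r\<ge>m. r \<le> max m y \<and> F r = y"
      using y assms(3)[of "max m y"] continuous_on_subset[OF assms(1)]
      by (intro IVT') (auto simp: max_def split: if_splits intro: order_trans)
    then show "y \<in> F ` {m..}" by auto
  qed
qed (use assms strict_mono_on_imp_inj_on in auto)

lemma strict_antimono_level_homeomorphism:
  fixes F :: "real \<Rightarrow> real"
  assumes "continuous_on {a..m} F" "strict_antimono_on {a..m} F" "a \<le> m"
  shows "\<exists>g. homeomorphism {a..m} {F m..F a} F g"
proof (rule homeomorphism_into_1d[OF convex_imp_path_connected])
  have anti: "F t \<le> F r" if "a \<le> r" "r \<le> t" "t \<le> m" for r t
    using that monotone_onD[OF assms(2), of r t] by (cases "r = t") auto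
  show "F ` {a..m} = {F m..F a}"
  proof (intro equalityI subsetI)
    fix y assume "y \<in> F ` {a..m}"
    then show "y \<in> {F m..F a}" using anti by auto
  next
    fix y assume "y \<in> {F m..F a}"
    then show "y \<in> F ` {a..m}"
      using IVT2'[of F m y a] assms by auto
  qed
  show "inj_on F {a..m}"
  proof (rule linorder_inj_onI)
    fix r t assume "r < t" "r \<in> {a..m}" "t \<in> {a..m}"
    then show "F r \<noteq> F t" using monotone_onD[OF assms(2)] by fastforce
  qed auto
qed (use assms in auto)

text \<open>A homeomorphism packages a branch together with its exact range of levels and a
  continuous inverse; the counts come from the former, the limits of the radii from the
  latter.\<close>

lemma homeomorphism_level_set:
  assumes "homeomorphism S T F g"
  shows "{r \<in> S. F r = y} = (if y \<in> T then {g y} else {})"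
  using assms unfolding homeomorphism_def by auto

text \<open>The two slopes share the bottom \<open>m\<close>, so at level \<open>F m\<close> both
  singletons coincide and the union has a single element.\<close>

lemma valley_level_set:
  fixes F :: "real \<Rightarrow> real"
  assumes "homeomorphism {a..m} {F m..F a} F gi" "homeomorphism {m..} {F m..} F go" "a \<le> m"
  shows "{r \<in> {a..}. F r = y} =
    (if y \<in> {F m..F a} then {gi y} else {}) \<union> (if y \<in> {F m..} then {go y} else {})"
proof -
  have "{r \<in> {a..}. F r = y} = {r \<in> {a..m}. F r = y} \<union> {r \<in> {m..}. F r = y}"
    using assms(3) by auto
  then show ?thesis
    unfolding homeomorphism_level_set[OF assms(1)] homeomorphism_level_set[OF assms(2)] .
qed

section \<open>Counting equilibria: the valley case and the increasing case\<close>

theorem theorem4p3p4: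
  fixes x1 x2 M1 M2 :: real
  assumes "x1 > 0" "x2 > 0" "x1 + x2 = 1"
    and "M1 > 0" "M2 > 0" "M1 + M2 = 1"
  shows
    "(0 < critical_mass x1 x2 \<and> critical_mass x1 x2 < 1 \<and>
      (\<forall>L. finite (isosceles_RE_radii x1 x2 M1 L)) \<and>
      range (\<lambda>L. card (isosceles_RE_radii x1 x2 M1 L)) =
        (if M1 < critical_mass x1 x2 then {0, 1, 2} else {0, 1}))
     \<and>
     (M1 < critical_mass x1 x2 \<longrightarrow>
       min_radius x1 x2 < r_bif x1 x2 M1 \<and>
       0 < L_bif x1 x2 M1 M2 \<and>
       (L_bif x1 x2 M1 M2)\<^sup>2 < bifurcation_curve x1 x2 M1 (min_radius x1 x2) \<and>
       (\<forall>L. L\<^sup>2 < (L_bif x1 x2 M1 M2)\<^sup>2 \<longrightarrow> isosceles_RE_radii x1 x2 M1 L = {}) \<and>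
       (\<forall>L. L\<^sup>2 = (L_bif x1 x2 M1 M2)\<^sup>2 \<longrightarrow> isosceles_RE_radii x1 x2 M1 L = {r_bif x1 x2 M1}) \<and>
       (\<forall>L. (L_bif x1 x2 M1 M2)\<^sup>2 < L\<^sup>2 \<and>
            L\<^sup>2 < bifurcation_curve x1 x2 M1 (min_radius x1 x2) \<longrightarrow>
            card (isosceles_RE_radii x1 x2 M1 L) = 2) \<and>
       (\<forall>L. bifurcation_curve x1 x2 M1 (min_radius x1 x2) < L\<^sup>2 \<longrightarrow>
            card (isosceles_RE_radii x1 x2 M1 L) = 1) \<and>
       (\<exists>\<rho>\<^sub>i \<rho>\<^sub>o :: real \<Rightarrow> real.
          continuous_on {(L_bif x1 x2 M1 M2)\<^sup>2 <..<
            bifurcation_curve x1 x2 M1 (min_radius x1 x2)} \<rho>\<^sub>i \<and>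
          continuous_on {(L_bif x1 x2 M1 M2)\<^sup>2 <..} \<rho>\<^sub>o \<and>
          (\<forall>L. (L_bif x1 x2 M1 M2)\<^sup>2 < L\<^sup>2 \<and>
               L\<^sup>2 < bifurcation_curve x1 x2 M1 (min_radius x1 x2) \<longrightarrow>
               isosceles_RE_radii x1 x2 M1 L = {\<rho>\<^sub>i (L\<^sup>2), \<rho>\<^sub>o (L\<^sup>2)} \<and>
               \<rho>\<^sub>i (L\<^sup>2) < r_bif x1 x2 M1 \<and> r_bif x1 x2 M1 < \<rho>\<^sub>o (L\<^sup>2)) \<and>
          (\<rho>\<^sub>i \<longlongrightarrow> r_bif x1 x2 M1) (at_right ((L_bif x1 x2 M1 M2)\<^sup>2)) \<and>
          (\<rho>\<^sub>o \<longlongrightarrow> r_bif x1 x2 M1) (at_right ((L_bif x1 x2 M1 M2)\<^sup>2)) \<and>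
          (\<rho>\<^sub>i \<longlongrightarrow> min_radius x1 x2)
            (at_left (bifurcation_curve x1 x2 M1 (min_radius x1 x2))) \<and>
          (\<forall>L. L\<^sup>2 = bifurcation_curve x1 x2 M1 (min_radius x1 x2) \<longrightarrow>
               isosceles_RE_radii x1 x2 M1 L =
                 {r \<in> {min_radius x1 x2, \<rho>\<^sub>o (L\<^sup>2)}. r > 0}) \<and>
          (\<forall>L. bifurcation_curve x1 x2 M1 (min_radius x1 x2) < L\<^sup>2 \<longrightarrow>
               isosceles_RE_radii x1 x2 M1 L = {\<rho>\<^sub>o (L\<^sup>2)})))
     \<and>
     (critical_mass x1 x2 \<le> M1 \<longrightarrow>
       (\<forall>r > min_radius x1 x2.
          \<not> local_min_on (bifurcation_curve x1 x2 M1) {min_radius x1 x2..} r) \<and>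
       (\<forall>r \<ge> min_radius x1 x2.
          bifurcation_curve x1 x2 M1 (min_radius x1 x2) \<le> bifurcation_curve x1 x2 M1 r) \<and>
       0 < bifurcation_curve x1 x2 M1 (min_radius x1 x2) \<and>
       (\<forall>L. L\<^sup>2 < bifurcation_curve x1 x2 M1 (min_radius x1 x2) \<longrightarrow>
            isosceles_RE_radii x1 x2 M1 L = {}) \<and>
       (\<forall>L. L\<^sup>2 = bifurcation_curve x1 x2 M1 (min_radius x1 x2) \<longrightarrow>
            isosceles_RE_radii x1 x2 M1 L = {r \<in> {min_radius x1 x2}. r > 0}) \<and>
       (\<forall>L. bifurcation_curve x1 x2 M1 (min_radius x1 x2) < L\<^sup>2 \<longrightarrow>
            card (isosceles_RE_radii x1 x2 M1 L) = 1))"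
proof -
  note x = \<open>x1 > 0\<close> \<open>x2 > 0\<close> and M = \<open>M1 > 0\<close> \<open>M2 > 0\<close> \<open>M1 + M2 = 1\<close>
  let ?F = "bifurcation_curve x1 x2 M1" and ?a = "min_radius x1 x2" and ?m = "r_bif x1 x2 M1"
  let ?RE = "isosceles_RE_radii x1 x2 M1"
  have B: "inertia x1 x2 M1 > 0" and a: "?a \<ge> 0"
    using x M by (simp_all add: inertia_def min_radius_def)
  note RE = isosceles_RE_radii_eq[OF x \<open>x1 + x2 = 1\<close> \<open>M1 > 0\<close>]
  note cont = bifurcation_curve_continuous[OF B \<open>M1 > 0\<close>]
  have ge: "r \<le> ?F r" for r
    using bifurcation_curve_ge[OF B] M by simp
  note F_pos = bifurcation_curve_pos[OF B \<open>M1 > 0\<close>]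
  have crit: "0 < critical_mass x1 x2" "critical_mass x1 x2 < 1"
    using critical_mass_bounds[OF x] by simp_all
  show ?thesis
  proof (cases "M1 < critical_mass x1 x2")
    case True
    then have M1: "M1 \<le> 3 / 4"
      using critical_mass_bounds[OF x] by simp
    have m2: "?m\<^sup>2 = inertia x1 x2 M1 * (3 - 4 * M1)" and m0: "?m \<ge> 0"
      using B M1 by (simp_all add: r_bif_def)
    then have "?a\<^sup>2 < ?m\<^sup>2"
      using True less_critical_mass_iff[OF x \<open>M1 > 0\<close>] by simp
    then have am: "?a < ?m"
      using m0 by (rule power_less_imp_less_base)
    have Lb: "(L_bif x1 x2 M1 M2)\<^sup>2 = ?F ?m"
      using L_bif_squared[OF B] M M1 by simp
    have Lb_pos: "0 < L_bif x1 x2 M1 M2"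
      using B M by (simp add: L_bif_def)
    note anti = bifurcation_curve_strict_antimono[OF B \<open>M1 > 0\<close> a eq_refl[OF m2]]
    obtain gi where gi: "homeomorphism {?a..?m} {?F ?m..?F ?a} ?F gi"
      using strict_antimono_level_homeomorphism[OF cont anti] am by auto
    obtain go where go: "homeomorphism {?m..} {?F ?m..} ?F go"
      using strict_mono_level_homeomorphism[OF cont
          bifurcation_curve_strict_mono[OF B \<open>M1 > 0\<close> m0 eq_refl[OF m2[symmetric]]] ge] by auto
    note level = valley_level_set[OF gi go less_imp_le[OF am]]
    have gi_ends: "gi (?F ?a) = ?a" "gi (?F ?m) = ?m" and go_m: "go (?F ?m) = ?m"
      using am by (simp_all add: homeomorphism_apply1[OF gi] homeomorphism_apply1[OF go])
    have Fma: "?F ?m < ?F ?a"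
      using monotone_onD[OF anti, of ?a ?m] am by simp
    have gi_mem: "gi y \<in> {?a..?m}" "?F (gi y) = y" if "?F ?m \<le> y" "y \<le> ?F ?a" for y
      using homeomorphism_image2[OF gi] homeomorphism_apply2[OF gi] that by auto
    have go_mem: "?m \<le> go y" "?F (go y) = y" if "?F ?m \<le> y" for y
      using homeomorphism_image2[OF go] homeomorphism_apply2[OF go] that by auto
    \<comment> \<open>Strictness is read off from the levels: a radius equal to \<open>?m\<close>
      would have level \<open>?F ?m\<close>, not \<open>y\<close>.\<close>
    have gi_less: "gi y < ?m" if "?F ?m < y" "y < ?F ?a" for y
      using gi_mem[of y] that by (cases "gi y = ?m") auto
    have go_greater: "?m < go y" if "?F ?m < y" for y
      using go_mem[of y] that by (cases "go y = ?m") auto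
    \<comment> \<open>This matters when \<open>x1 = x2\<close>, where \<open>?a = 0\<close>:
      strictly below level \<open>?F ?a\<close> the inner radius has not yet reached the
      origin.\<close>
    have gi_pos: "0 < gi y" if "?F ?m < y" "y < ?F ?a" for y
      using gi_mem[of y] that a by (cases "gi y = ?a") auto
    have go_pos: "0 < go y" if "?F ?m \<le> y" for y
      using go_mem[of y] that a am by linarith
    have below: "?RE L = {}" if "L\<^sup>2 < ?F ?m" for L
      unfolding RE level using that Fma by simp
    have bottom: "?RE L = {?m}" if "L\<^sup>2 = ?F ?m" for L
      unfolding RE level using that Fma am a by (simp add: gi_ends go_m)
    have middle: "?RE L = {gi (L\<^sup>2), go (L\<^sup>2)}" if "?F ?m < L\<^sup>2" "L\<^sup>2 < ?F ?a" for L
      unfolding RE level using that gi_pos go_pos by auto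
    \<comment> \<open>At this level the inner radius is \<open>?a\<close> itself. It counts as an
      equilibrium unless \<open>x1 = x2\<close>, when it is the origin, so there are two or
      one.\<close>
    have merge: "?RE L = {r \<in> {?a, go (L\<^sup>2)}. r > 0}" if "L\<^sup>2 = ?F ?a" for L
      unfolding RE level using that Fma by (auto simp: gi_ends)
    have above: "?RE L = {go (L\<^sup>2)}" if "?F ?a < L\<^sup>2" for L
      unfolding RE level using that Fma go_pos by auto
    have one: "card (?RE L) = 1" if "?F ?a < L\<^sup>2" for L
      using above[OF that] by simp
    have two: "card (?RE L) = 2" if "?F ?m < L\<^sup>2" "L\<^sup>2 < ?F ?a" for L
      using middle[OF that] gi_less[of "L\<^sup>2"] go_greater[of "L\<^sup>2"] that by simp
    have fin_card: "finite (?RE L) \<and> card (?RE L) \<in> {0, 1, 2}" for L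
    proof -
      consider "L\<^sup>2 < ?F ?m" | "L\<^sup>2 = ?F ?m" | "?F ?m < L\<^sup>2" "L\<^sup>2 < ?F ?a" | "L\<^sup>2 = ?F ?a" | "?F ?a < L\<^sup>2"
        by linarith
      then show ?thesis
      proof cases
        case 4
        have "card {r \<in> {?a, go (L\<^sup>2)}. r > 0} \<le> card {?a, go (L\<^sup>2)}"
          by (intro card_mono) auto
        also have "\<dots> \<le> 2"
          using card_insert_le_m1[of 2 "{go (L\<^sup>2)}" ?a] by simp
        finally have "card (?RE L) \<le> 2"
          unfolding merge[OF 4] .
        then have "card (?RE L) \<in> {0, 1, 2}"
          unfolding insert_iff by linarith
        then show ?thesis
          unfolding merge[OF 4] by simp
      next
        case 3
        \<comment> \<open>\<open>card\<close> is 0 on infinite sets, so the nonzero cardinality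
          already gives finiteness.\<close>
        then show ?thesis
          using two[OF 3] by (auto intro: card_ge_0_finite)
      qed (simp_all add: below bottom above)
    qed
    have range: "range (\<lambda>L. card (?RE L)) = {0, 1, 2}"
    proof -
      have attained: "n \<in> range (\<lambda>L. card (?RE L))" if "card (?RE L) = n" for n L
        using that by blast
      \<comment> \<open>The three counts are realized by level 0, which lies below the positive
        curve, by a level above \<open>?F ?a\<close>, and by the midpoint of \<open>?F ?m\<close>
        and \<open>?F ?a\<close>.\<close>
      have c0: "card (?RE 0) = 0"
        using below[of 0] F_pos by simp
      have c1: "card (?RE (sqrt (?F ?a + 1))) = 1"
        using above[of "sqrt (?F ?a + 1)"] F_pos[of ?a] by simp
      have c2: "card (?RE (sqrt ((?F ?m + ?F ?a) / 2))) = 2"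
        using two[of "sqrt ((?F ?m + ?F ?a) / 2)"] F_pos[of ?a] F_pos[of ?m] Fma by simp
      show ?thesis
        using attained[OF c0] attained[OF c1] attained[OF c2]
        by (intro equalityI image_subsetI conjunct2[OF fin_card]) simp
    qed
    have gi_cont: "continuous_on {?F ?m..?F ?a} gi" and go_cont: "continuous_on {?F ?m..} go"
      using homeomorphism_cont2[OF gi] homeomorphism_cont2[OF go] by auto
    \<comment> \<open>The inverses are continuous on closed level intervals, so the one-sided limits
      at the ends are simply their values there.\<close>
    have "(gi \<longlongrightarrow> gi (?F ?m)) (at (?F ?m) within {?F ?m..?F ?a})"
      "(gi \<longlongrightarrow> gi (?F ?a)) (at (?F ?a) within {?F ?m..?F ?a})"
      "(go \<longlongrightarrow> go (?F ?m)) (at (?F ?m) within {?F ?m..})"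
      using gi_cont go_cont Fma by (simp_all add: continuous_on_def)
    then have lims: "(gi \<longlongrightarrow> ?m) (at_right (?F ?m))" "(gi \<longlongrightarrow> ?a) (at_left (?F ?a))"
      "(go \<longlongrightarrow> ?m) (at_right (?F ?m))"
      using Fma
      by (simp_all add: gi_ends go_m at_within_Icc_at_right at_within_Icc_at_left at_within_Ici_at_right)
    have conts: "continuous_on {?F ?m<..<?F ?a} gi" "continuous_on {?F ?m<..} go"
      using gi_cont go_cont by (auto elim: continuous_on_subset)
    have fin: "finite (?RE L)" for L
      using fin_card by blast
    have not_ge: "\<not> critical_mass x1 x2 \<le> M1"
      using True by simp
    note plain = crit fin range am Lb_pos Fma conts lims
    note conditional = below bottom one two middle merge above gi_less go_greater
    show ?thesis
      \<comment> \<open>The conjunct for large \<open>M1\<close> is vacuous by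
        \<open>not_ge\<close>. The existence of the two branches is left for last, with
        \<open>gi\<close> and \<open>go\<close> as witnesses.\<close>
      unfolding Lb if_P[OF True]
      by (intro conjI allI impI; (elim conjE)?;
          (rule plain | (rule conditional; assumption) | (rule notE[OF not_ge], assumption))?)
        (rule exI[of _ gi], rule exI[of _ go], (intro conjI allI impI; (elim conjE)?;
          (rule plain | (rule conditional; assumption))))
  next
    case False
    then have "inertia x1 x2 M1 * (3 - 4 * M1) \<le> ?a\<^sup>2"
      using less_critical_mass_iff[OF x \<open>M1 > 0\<close>] by simp
    note mono = bifurcation_curve_strict_mono[OF B \<open>M1 > 0\<close> a this]
    obtain g where g: "homeomorphism {?a..} {?F ?a..} ?F g"
      using strict_mono_level_homeomorphism[OF cont mono ge] by auto
    note level = homeomorphism_level_set[OF g]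
    have g_a: "g (?F ?a) = ?a"
      by (simp add: homeomorphism_apply1[OF g])
    have g_pos: "0 < g y" if "?F ?a < y" for y
    proof -
      have "?a \<le> g y" "?F (g y) = y"
        using homeomorphism_image2[OF g] homeomorphism_apply2[OF g] that by auto
      then show ?thesis
        using that a by (cases "g y = ?a") auto
    qed
    have below: "?RE L = {}" if "L\<^sup>2 < ?F ?a" for L
      unfolding RE level using that by simp
    \<comment> \<open>The lowest level carries the single radius \<open>?a\<close>, or none if
      \<open>x1 = x2\<close> puts it at the origin.\<close>
    have bottom: "?RE L = {r \<in> {?a}. r > 0}" if "L\<^sup>2 = ?F ?a" for L
      unfolding RE level using that by (auto simp: g_a)
    have above: "card (?RE L) = 1" if "?F ?a < L\<^sup>2" for L
      unfolding RE level using that g_pos[of "L\<^sup>2"] by simp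
    have fin_card: "finite (?RE L) \<and> card (?RE L) \<in> {0, 1}" for L
    proof (cases "L\<^sup>2" "?F ?a" rule: linorder_cases)
      case equal
      have "{r \<in> {?a}. r > 0} = (if 0 < ?a then {?a} else {})"
        by auto
      then show ?thesis
        unfolding bottom[OF equal] by simp
    next
      case greater
      then show ?thesis
        using above[OF greater] by (auto intro: card_ge_0_finite)
    qed (use below in simp)
    have range: "range (\<lambda>L. card (?RE L)) = {0, 1}"
    proof -
      have attained: "n \<in> range (\<lambda>L. card (?RE L))" if "card (?RE L) = n" for n L
        using that by blast
      have c0: "card (?RE 0) = 0"
        using below[of 0] F_pos by simp
      have c1: "card (?RE (sqrt (?F ?a + 1))) = 1"
        using above[of "sqrt (?F ?a + 1)"] F_pos[of ?a] by simp
      show ?thesis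
        using attained[OF c0] attained[OF c1]
        by (intro equalityI image_subsetI conjunct2[OF fin_card]) simp
    qed
    have no_min: "\<not> local_min_on ?F {?a..} r" if r: "r > ?a" for r
    proof
      assume "local_min_on ?F {?a..} r"
      then have "\<forall>\<^sub>F y in at r within {?a..}. ?F r \<le> ?F y"
        by (simp add: local_min_on_def)
      \<comment> \<open>As \<open>r\<close> is interior, a local minimum would also bound the values
        just to its left, where the strictly increasing curve is smaller. The contradiction follows
        because \<open>at_left r\<close> is a nontrivial filter.\<close>
      moreover have "at r within {?a..} = at r"
        using r by (intro at_within_interior) simp
      ultimately have "\<forall>\<^sub>F y in at_left r. ?F r \<le> ?F y"
        by (simp add: eventually_at_split)
      moreover have "\<forall>\<^sub>F y in at_left r. y \<in> {?a<..<r}"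
        using r by (rule eventually_at_left_real)
      ultimately have "\<forall>\<^sub>F y in at_left r. False"
      proof eventually_elim
        case (elim y)
        then show False
          using strict_mono_onD[OF mono, of y r] r by simp
      qed
      then show False
        by simp
    qed
    have min: "?F ?a \<le> ?F r" if "?a \<le> r" for r
      using strict_mono_on_leD[OF mono] that by simp
    show ?thesis
      using False crit fin_card range no_min min F_pos[of ?a] below bottom above by simp
  qed
qed

end
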